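(* Let $(\mathbf{X}, d)$ be a proper geodesic space and let $\Omega\subsetneq \mathbf{X}$ be a bounded domain satisfying $\partial\Omega=\partial\overline{\Omega}$. Assume that for any $\delta>0$ there exists a bounded domain $\Omega_\delta\subsetneq\mathbf{X}$ such that $\overline{\Omega}\subset\Omega_\delta\subset\mathcal{N}_\delta(\Omega)$, $\partial\Omega_\delta=\partial\overline{\Omega_\delta}$, $$\min_{x\in\overline{\Omega}}d(x,\partial\Omega_\delta)>0,$$ and $\mathcal{O}=\Omega_\delta$ satisfies the regularity assumption (A) given in the context. Let $\Lambda_\infty=1/\max_{x\in\overline{\Omega}}d(x,\partial\Omega)$ and let $\lambda<\Lambda_\infty$. If $u\in C(\overline{\Omega})$ is a subsolution of $\min\{|\nabla u|-\lambda u,-\Delta_\infty u\}=0$ in $\Omega$ and $u\le0$ on $\partial\Omega$, then $u\le0$ in $\overline{\Omega}$.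
   Context: A metric space $(\mathbf{X},d)$ is a geodesic space if any $x,y\in\mathbf{X}$ are joined by a Lipschitz curve of length $d(x,y)$; it is proper if all closed balls $\overline{B_r(x)}$ are compact. $B_r(x)$ is the open metric ball. A domain is a nonempty connected open set; $d(x,E)=\min_{y\in E}d(x,y)$ for compact $E$. $\mathcal{O}\subset\subset\Omega$ means $\overline{\mathcal{O}}\subset\Omega$. For $r>0$, $\mathcal{N}_r(\mathcal{O})=\{x\in\mathbf{X}:d(x,\overline{\mathcal{O}})<r\}$. Assumption (A) for a bounded domain $\mathcal{O}\subsetneq\mathbf{X}$: for any $x_0\in\mathcal{O}$ and $\varepsilon>0$ there exist $r_0>0$ and a domain $E^\varepsilon_{x_0}(\mathcal{O})\subsetneq\mathbf{X}$ such that (i) $\mathcal{O}\subset E^\varepsilon_{x_0}(\mathcal{O})\subset\mathcal{N}_\varepsilon(\mathcal{O})$; (ii) $d(x_0,\partial E^\varepsilon_{x_0}(\mathcal{O}))=d(x_0,\partial\mathcal{O})$; (iii) $d(x,\partial E^\varepsilon_{x_0}(\mathcal{O}))>d(x,\partial\mathcal{O})$ whenever $x\in B_{r_0}(x_0)\setminus\{x_0\}$ satisfies $d(x,\partial\mathcal{O})=d(x_0,\partial\mathcal{O})$. $\infty$-superharmonic: for a bounded domain $D\subsetneq\mathbf{X}$ (such as a ball $B_{r_0}(x_0)\subset\Omega$), a function $v:D\to\mathbb{R}$ bounded from below is $\infty$-superharmonic in $D$ if it satisfies comparison with cones from below: for any $\hat{x}\in D$, $a\in\mathbb{R}$, $\kappa\le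 0$ and any bounded open set $\mathcal{O}\subset\subset D$ with $\hat{x}\in D\setminus\mathcal{O}$, if $v\ge\phi$ on $\partial\mathcal{O}$, where $\phi=a+\kappa d(\hat{x},\cdot)$, then $v\ge\phi$ in $\overline{\mathcal{O}}$. (Such functions are automatically locally Lipschitz.) Subslope: for locally Lipschitz $v$, $|\nabla^-v|(x)=\limsup_{y\to x}\frac{\max\{v(x)-v(y),0\}}{d(x,y)}$. Subsolution: for $\lambda\in\mathbb{R}$, a locally Lipschitz function $u$ in $\Omega$ is a subsolution of $\min\{|\nabla u|-\lambda u,-\Delta_\infty u\}=0$ in $\Omega$ if whenever there exist $x_0\in\Omega$, small $r_0>0$ and an $\infty$-superharmonic function $v$ in $B_{r_0}(x_0)\subset\Omega$ such that $u-v$ attains a strict local maximum at $x_0$, one has $$\lim_{r\to0+}\inf_{B_r(x_0)}|\nabla^-v|\le\lambda u(x_0).$$ (The symbols in the equation are only notation; its meaning is given by this definition.) *)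

theory Defs
  imports "HOL-Analysis.Analysis"
begin

(* The metric space X is the whole type 'a::metric_space. *)

(* Length of a curve: supremum of the inscribed polygonal sums over all finite
   increasing lists of parameters. *)
definition curve_length :: "real set \<Rightarrow> (real \<Rightarrow> 'a::metric_space) \<Rightarrow> ereal" where
  "curve_length I g =
     (SUP ts \<in> {ts. sorted ts \<and> set ts \<subseteq> I}.
        ereal (\<Sum>i<length ts - 1. dist (g (ts ! i)) (g (ts ! Suc i))))"

definition geodesic_space :: "'a::metric_space itself \<Rightarrow> bool" where
  "geodesic_space _ \<longleftrightarrow>
     (\<forall>x y::'a. \<exists>g::real \<Rightarrow> 'a. \<exists>L.
        L-lipschitz_on {0..1} g \<and> g 0 = x \<and> g 1 = y \<and>
        curve_length {0..1} g = ereal (dist x y))"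

definition proper_space :: "'a::metric_space itself \<Rightarrow> bool" where
  "proper_space _ \<longleftrightarrow> (\<forall>(x::'a) r. compact (cball x r))"

definition metric_domain :: "'a::metric_space set \<Rightarrow> bool" where
  "metric_domain U \<longleftrightarrow> U \<noteq> {} \<and> open U \<and> connected U"

(* The distance d(x,E) to a nonempty compact set E is the library's infdist x E
   (which is 0 if E is empty; in a connected space the frontier of a nonempty proper
   subset is never empty). *)
definition nbhd :: "real \<Rightarrow> 'a::metric_space set \<Rightarrow> 'a set" where
  "nbhd r U = {x. infdist x (closure U) < r}"

definition assumption_A :: "'a::metric_space set \<Rightarrow> bool" where
  "assumption_A U \<longleftrightarrow>
     (\<forall>x0\<in>U. \<forall>\<epsilon>>0. \<exists>r0>0. \<exists>E.
        metric_domain E \<and> E \<noteq> UNIV \<and>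
        U \<subseteq> E \<and> E \<subseteq> nbhd \<epsilon> U \<and>
        infdist x0 (frontier E) = infdist x0 (frontier U) \<and>
        (\<forall>x \<in> ball x0 r0 - {x0}.
           infdist x (frontier U) = infdist x0 (frontier U) \<longrightarrow>
           infdist x (frontier E) > infdist x (frontier U)))"

(* Comparison with cones from below. Only the values of v on D matter. The notion is
   meant for bounded domains D different from the whole space; it is applied below to
   balls contained in such a domain. *)
definition infinity_superharmonic :: "'a::metric_space set \<Rightarrow> ('a \<Rightarrow> real) \<Rightarrow> bool" where
  "infinity_superharmonic D v \<longleftrightarrow>
     bdd_below (v ` D) \<and>
     (\<forall>z\<in>D. \<forall>a \<kappa> U.
        \<kappa> \<le> 0 \<and> bounded U \<and> open U \<and> closure U \<subseteq> D \<and> z \<notin> U \<and>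
        (\<forall>y\<in>frontier U. v y \<ge> a + \<kappa> * dist z y) \<longrightarrow>
        (\<forall>y\<in>closure U. v y \<ge> a + \<kappa> * dist z y))"

definition locally_lipschitz_on :: "'a::metric_space set \<Rightarrow> ('a \<Rightarrow> real) \<Rightarrow> bool" where
  "locally_lipschitz_on U u \<longleftrightarrow> (\<forall>x\<in>U. \<exists>r>0. \<exists>L. L-lipschitz_on (ball x r \<inter> U) u)"

definition subslope :: "('a::metric_space \<Rightarrow> real) \<Rightarrow> 'a \<Rightarrow> ereal" where
  "subslope v x = Limsup (at x) (\<lambda>y. ereal (max (v x - v y) 0 / dist x y))"

definition lim_inf_subslope :: "('a::metric_space \<Rightarrow> real) \<Rightarrow> 'a \<Rightarrow> ereal" where
  "lim_inf_subslope v x0 = Lim (at_right (0::real)) (\<lambda>r. INF x\<in>ball x0 r. subslope v x)"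

(* The limit exists, by monotonicity in r, so the use of Lim is legitimate. *)
lemma tendsto_lim_inf_subslope:
  "((\<lambda>r. INF x\<in>ball x0 r. subslope v x) \<longlongrightarrow> lim_inf_subslope v x0) (at_right (0::real))"
proof -
  let ?F = "\<lambda>r::real. INF x\<in>ball x0 r. subslope v x"
  have anti: "?F s \<le> ?F r" if "r \<le> s" for r s
    using that by (intro INF_superset_mono) auto
  have "(?F \<longlongrightarrow> (SUP r\<in>{0<..}. ?F r)) (at_right 0)"
  proof (rule order_tendstoI)
    fix a assume "a < (SUP r\<in>{0<..}. ?F r)"
    then obtain s where s: "s > 0" "a < ?F s"
      by (auto simp: less_SUP_iff)
    have "a < ?F r" if "r < s" for r
      using s(2) anti[of r s] that by (meson less_imp_le less_le_trans)
    then show "eventually (\<lambda>r. a < ?F r) (at_right 0)"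
      using s(1) unfolding eventually_at_right_field by blast
  next
    fix a assume *: "(SUP r\<in>{0<..}. ?F r) < a"
    have "?F r < a" if "r > 0" for r
    proof -
      have "?F r \<le> (SUP r\<in>{0<..}. ?F r)"
        using that by (intro SUP_upper) auto
      then show ?thesis using * by (rule le_less_trans)
    qed
    then show "eventually (\<lambda>r. ?F r < a) (at_right 0)"
      unfolding eventually_at_right_field by (meson zero_less_one)
  qed
  then show ?thesis
    unfolding lim_inf_subslope_def using tendsto_Lim trivial_limit_at_right_real by metis
qed

definition strict_local_max :: "('a::metric_space \<Rightarrow> real) \<Rightarrow> 'a \<Rightarrow> bool" where
  "strict_local_max f x0 \<longleftrightarrow> eventually (\<lambda>x. f x < f x0) (at x0)"

(* Subsolutions of min {|grad u| - lambda u, - Delta_infinity u} = 0 in W. Since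
   superharmonicity passes to smaller balls, "small r0" imposes no further condition. *)
definition eikonal_infinity_subsolution ::
    "real \<Rightarrow> 'a::metric_space set \<Rightarrow> ('a \<Rightarrow> real) \<Rightarrow> bool" where
  "eikonal_infinity_subsolution l W u \<longleftrightarrow>
     locally_lipschitz_on W u \<and>
     (\<forall>x0\<in>W. \<forall>r0>0. \<forall>v.
        ball x0 r0 \<subseteq> W \<and> infinity_superharmonic (ball x0 r0) v \<and>
        strict_local_max (\<lambda>x. u x - v x) x0 \<longrightarrow>
        lim_inf_subslope v x0 \<le> ereal (l * u x0))"

end

theory Submission
  imports Defs
begin

text \<open>
  Suppose \<open>u\<close> is positive somewhere.  The idea is to touch \<open>u\<close> from above by a function of the
  distance to the boundary of a slightly larger domain.  Let \<open>W\<close> be one of the approximating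
  domains \<open>\<Omega>\<^sub>\<delta>\<close>, let \<open>w = d(\<cdot>, \<partial>W)\<close>, which is positive on the closure of \<open>\<Omega>\<close>, and let
  \<open>g(t) = t - \<epsilon> t\<^sup>2\<close> be a slightly concave profile.  The maximum \<open>M > 0\<close> of \<open>u / g(w)\<close> is attained
  at some \<open>x0 \<in> \<Omega>\<close>, so \<open>u \<le> M g(w)\<close> with equality at \<open>x0\<close>.  Let \<open>t0 = w(x0)\<close>.

  The function \<open>M g\<close> lies below its tangent line at \<open>t0\<close>, strictly away from \<open>t0\<close>.  Hence
  \<open>u < A + B w\<close> off the level set \<open>w = t0\<close>, where \<open>B = M g'(t0)\<close>.  On the level set, strictness
  comes from assumption (A): it supplies a domain \<open>E\<close> containing \<open>W\<close> whose boundary is no closer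
  to any point of \<open>W\<close>, equally far from \<open>x0\<close>, and strictly farther from the other nearby points of the
  level set.  So \<open>u - v\<close> has a strict local maximum at \<open>x0\<close> for \<open>v = A + B d(\<cdot>, \<partial>E)\<close>.  This \<open>v\<close>
  is affine in a distance function, so it is \<open>\<infinity>\<close>-superharmonic
  (\<open>infinity_superharmonic_affine_infdist\<close>) and its subslope is at least \<open>B\<close> everywhere
  (\<open>subslope_affine_infdist_ge\<close>).  The definition of a subsolution then gives
  \<open>M g'(t0) \<le> \<lambda> M g(t0)\<close>.

  As \<open>\<delta>\<close> and \<open>\<epsilon>\<close> tend to \<open>0\<close>, the inequality \<open>g'(t0) \<le> \<lambda> g(t0)\<close> degenerates to
  \<open>1 \<le> \<lambda> t0\<close>, where \<open>t0\<close> is asymptotically at most the inradius of \<open>\<Omega>\<close>.  This contradicts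
  \<open>\<lambda> < \<Lambda>\<^sub>\<infinity>\<close>, so it fails already for small \<open>\<delta>\<close> and \<open>\<epsilon>\<close>.  That the inradius does not jump
  under the approximation (\<open>infdist_frontier_approximation\<close>) is where
  \<open>\<partial>\<Omega> = \<partial>(closure \<Omega>)\<close> enters.
\<close>

section \<open>Geodesics and distance to the boundary\<close>

text \<open>
  Everything the proof needs from geodesics: a geodesic from inside to outside crosses the
  frontier, and no length is lost at the crossing point.
\<close>

lemma geodesic_crosses_frontier:
  fixes U :: "'a::metric_space set"
  assumes geo: "geodesic_space TYPE('a)" and "x \<in> U" "p \<notin> U"
  obtains q where "q \<in> frontier U" "dist x q + dist q p = dist x p"
proof -
  obtain g :: "real \<Rightarrow> 'a" and L where g: "L-lipschitz_on {0..1} g" "g 0 = x" "g 1 = p"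
    and len: "curve_length {0..1} g = ereal (dist x p)"
    using geo unfolding geodesic_space_def by meson
  have "connected (g ` {0..1})"
    using lipschitz_on_continuous_on[OF g(1)] by (intro connected_continuous_image) auto
  moreover have "x \<in> g ` {0..1}" "p \<in> g ` {0..1}"
    using g(2,3) by force+
  ultimately have "g ` {0..1} \<inter> frontier U \<noteq> {}"
    using assms(2,3) by (intro connected_Int_frontier) auto
  then obtain t where t: "t \<in> {0..1}" "g t \<in> frontier U"
    by blast
  let ?ts = "[0, t, 1::real]"
  have "ereal (\<Sum>i<length ?ts - 1. dist (g (?ts ! i)) (g (?ts ! Suc i))) \<le> curve_length {0..1} g"
    unfolding curve_length_def using t(1) by (intro SUP_upper) auto
  then have "dist x (g t) + dist (g t) p \<le> dist x p"
    using g(2,3) len by (simp add: numeral_2_eq_2)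
  then show ?thesis
    using that[OF t(2)] dist_triangle[of x p "g t"] by linarith
qed

lemma geodesic_space_frontier_nonempty:
  fixes U :: "'a::metric_space set"
  assumes "geodesic_space TYPE('a)" "U \<noteq> {}" "U \<noteq> UNIV"
  shows "frontier U \<noteq> {}"
proof -
  obtain x p where "x \<in> U" "p \<notin> U" using assms(2,3) by blast
  then obtain q where "q \<in> frontier U"
    using geodesic_crosses_frontier[OF assms(1)] by metis
  then show ?thesis by blast
qed

lemma infdist_frontier_le_dist_outside:
  fixes U :: "'a::metric_space set"
  assumes "geodesic_space TYPE('a)" "x \<in> U" "p \<notin> U"
  shows "infdist x (frontier U) \<le> dist x p"
proof -
  obtain q where "q \<in> frontier U" "dist x q + dist q p = dist x p"
    using geodesic_crosses_frontier[OF assms] .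
  then show ?thesis
    using infdist_le[of q "frontier U" x] zero_le_dist[of q p] by linarith
qed

lemma infdist_frontier_mono:
  fixes U E :: "'a::metric_space set"
  assumes geo: "geodesic_space TYPE('a)" and "x \<in> U" "U \<subseteq> E" "open E" "E \<noteq> UNIV"
  shows "infdist x (frontier U) \<le> infdist x (frontier E)"
proof -
  have ne: "frontier E \<noteq> {}"
    using geodesic_space_frontier_nonempty[OF geo, of E] assms by blast
  have "infdist x (frontier U) \<le> dist x p" if "p \<in> frontier E" for p
    using that assms infdist_frontier_le_dist_outside[OF geo, of x U p]
    by (auto simp: frontier_def interior_open)
  then show ?thesis
    using ne by (simp add: infdist_def[of x "frontier E"] cINF_greatest)
qed

lemma proper_space_infdist_attained:
  fixes S :: "'a::metric_space set"
  assumes "proper_space TYPE('a)" "closed S" "S \<noteq> {}"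
  obtains p where "p \<in> S" "infdist x S = dist x p"
proof -
  obtain s where s: "s \<in> S" using assms(3) by blast
  let ?K = "cball x (dist x s) \<inter> S"
  have "compact ?K" "?K \<noteq> {}"
    using assms s unfolding proper_space_def by (auto intro: compact_Int_closed)
  moreover have "continuous_on ?K (dist x)" by (intro continuous_intros)
  ultimately obtain p where p: "p \<in> ?K" "\<And>q. q \<in> ?K \<Longrightarrow> dist x p \<le> dist x q"
    using continuous_attains_inf[of ?K "dist x"] by metis
  have "dist x p \<le> dist x q" if "q \<in> S" for q
    using p that by (cases "q \<in> ?K") auto
  then have "dist x p \<le> infdist x S"
    using assms(3) by (simp add: infdist_def cINF_greatest)
  then show ?thesis
    using that p(1) infdist_le[of p S x] by (auto intro: antisym)
qed

section \<open>Affine functions of the distance to the boundary as test functions\<close>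

text \<open>
  Comparison with cones.  A cone of slope at most \<open>1\<close> is compared along a geodesic from the point
  to the boundary, on which the distance function decreases at the maximal rate \<open>1\<close>.  A steeper
  cone is compared along a geodesic to the vertex, on which the cone grows faster than the
  \<open>1\<close>-Lipschitz distance function can.
\<close>

lemma infdist_frontier_cone_comparison:
  fixes E U :: "'a::metric_space set"
  assumes geo: "geodesic_space TYPE('a)" and E: "open E" "E \<noteq> UNIV"
    and U: "U \<subseteq> E" and z: "z \<notin> U" and k: "\<kappa> \<le> 0" and y: "y \<in> U"
    and bd: "\<And>q. q \<in> frontier U \<Longrightarrow> a + \<kappa> * dist z q \<le> infdist q (frontier E)"
  shows "a + \<kappa> * dist z y \<le> infdist y (frontier E)"
proof (cases "\<kappa> < -1")
  case True
  obtain q where q: "q \<in> frontier U" "dist y q + dist q z = dist y z"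
    using geodesic_crosses_frontier[OF geo y z] .
  have split: "dist z y = dist z q + dist y q"
    using q(2) by (metis add.commute dist_commute)
  have "a + \<kappa> * dist z y = a + \<kappa> * dist z q + \<kappa> * dist y q"
    unfolding split by (simp add: algebra_simps)
  also have "\<dots> \<le> infdist q (frontier E) + \<kappa> * dist y q"
    using bd[OF q(1)] by simp
  also have "\<dots> \<le> infdist q (frontier E) - dist y q"
    using mult_right_mono[of \<kappa> "-1" "dist y q"] True by simp
  also have "\<dots> \<le> infdist y (frontier E)"
    using infdist_triangle[of q "frontier E" y] by (simp add: dist_commute)
  finally show ?thesis .
next
  case False
  have ne: "frontier E \<noteq> {}"
    using geodesic_space_frontier_nonempty[OF geo, of E] E U y by blast
  have "a + \<kappa> * dist z y \<le> dist y p" if p: "p \<in> frontier E" for p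
  proof -
    have "p \<notin> U" using p E U by (auto simp: frontier_def interior_open)
    then obtain q where q: "q \<in> frontier U" "dist y q + dist q p = dist y p"
      using geodesic_crosses_frontier[OF geo y] by blast
    have "\<kappa> * dist z y \<le> \<kappa> * (dist z q - dist y q)"
      using k dist_triangle[of z q y] by (intro mult_left_mono_neg) (simp_all add: dist_commute)
    also have "\<dots> \<le> \<kappa> * dist z q + dist y q"
      using False mult_right_mono[of "-1" \<kappa> "dist y q"] by (simp add: algebra_simps)
    finally show ?thesis
      using bd[OF q(1)] infdist_le[OF p, of q] q(2) by linarith
  qed
  then show ?thesis
    using ne by (simp add: infdist_def[of y "frontier E"] cINF_greatest)
qed

lemma infinity_superharmonic_affine_infdist:
  fixes D E :: "'a::metric_space set"
  assumes geo: "geodesic_space TYPE('a)" and E: "open E" "E \<noteq> UNIV" and D: "D \<subseteq> E"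
    and B: "B > 0"
  shows "infinity_superharmonic D (\<lambda>x. A + B * infdist x (frontier E))"
  unfolding infinity_superharmonic_def
proof (intro conjI ballI allI impI)
  show "bdd_below ((\<lambda>x. A + B * infdist x (frontier E)) ` D)"
    using B by (intro bdd_belowI[of _ A]) (auto simp: infdist_nonneg)
next
  fix z a \<kappa> U y
  assume "z \<in> D" and H: "\<kappa> \<le> 0 \<and> bounded U \<and> open U \<and> closure U \<subseteq> D \<and> z \<notin> U \<and>
     (\<forall>y\<in>frontier U. A + B * infdist y (frontier E) \<ge> a + \<kappa> * dist z y)"
    and y: "y \<in> closure U"
  have scale: "A + B * d \<ge> a + \<kappa> * c \<longleftrightarrow> (a - A) / B + \<kappa> / B * c \<le> d" for c d
  proof -
    have "(a - A) / B + \<kappa> / B * c = (a + \<kappa> * c - A) / B"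
      by (simp add: add_divide_distrib diff_divide_distrib)
    then show ?thesis using B by (auto simp: pos_divide_le_eq mult.commute)
  qed
  show "A + B * infdist y (frontier E) \<ge> a + \<kappa> * dist z y"
  proof (cases "y \<in> U")
    case True
    have "U \<subseteq> E" using H D closure_subset[of U] by blast
    moreover have "\<kappa> / B \<le> 0" using H B by (simp add: divide_nonpos_pos)
    moreover have "(a - A) / B + \<kappa> / B * dist z q \<le> infdist q (frontier E)"
      if "q \<in> frontier U" for q
      using H that scale by blast
    moreover have "z \<notin> U" using H by blast
    ultimately have "(a - A) / B + \<kappa> / B * dist z y \<le> infdist y (frontier E)"
      using infdist_frontier_cone_comparison[OF geo E, of U z "\<kappa> / B" y "(a - A) / B"] True
      by simp
    then show ?thesis by (simp only: scale)
  next
    case False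
    then show ?thesis using y H by (auto simp: frontier_def interior_open)
  qed
qed

text \<open>
  Moving from \<open>x\<close> towards a nearest boundary point decreases the distance at unit rate.
\<close>

lemma subslope_affine_infdist_ge:
  fixes E :: "'a::metric_space set"
  assumes proper: "proper_space TYPE('a)" and geo: "geodesic_space TYPE('a)"
    and E: "open E" "E \<noteq> UNIV" and x: "x \<in> E" and B: "B > 0"
  shows "ereal B \<le> subslope (\<lambda>y. A + B * infdist y (frontier E)) x"
proof -
  let ?w = "\<lambda>y. infdist y (frontier E)"
  have ne: "frontier E \<noteq> {}"
    using geodesic_space_frontier_nonempty[OF geo, of E] E x by blast
  obtain p where p: "p \<in> frontier E" "?w x = dist x p"
    using proper_space_infdist_attained[OF proper frontier_closed ne] .
  have "p \<noteq> x" using p x E by (auto simp: frontier_def interior_open)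
  have near: "\<exists>q. q \<noteq> x \<and> dist q x < e \<and> B \<le> max ((A + B * ?w x) - (A + B * ?w q)) 0 / dist x q"
    if "e > 0" for e
  proof -
    \<comment> \<open>The point at distance \<open>s\<close> from \<open>x\<close> on the geodesic is where it leaves \<open>ball x s\<close>.\<close>
    define s where "s = min (e / 2) (dist x p)"
    have s: "s > 0" "s < e" "s \<le> dist x p"
      using \<open>e > 0\<close> \<open>p \<noteq> x\<close> by (auto simp: s_def)
    then obtain q where q: "q \<in> frontier (ball x s)" "dist x q + dist q p = dist x p"
      using geodesic_crosses_frontier[OF geo, of x "ball x s" p] by auto
    have "q \<in> cball x s - ball x s"
      using q(1) closure_minimal[of "ball x s" "cball x s"]
      by (auto simp: frontier_def interior_open)
    then have d: "dist x q = s" by auto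
    have "dist x q \<le> ?w x - ?w q"
      using infdist_le[OF p(1), of q] p(2) q(2) by linarith
    then have "B * dist x q \<le> (A + B * ?w x) - (A + B * ?w q)"
      using B by (simp flip: right_diff_distrib)
    then show ?thesis
      using d s by (intro exI[of _ q]) (auto simp: dist_commute pos_le_divide_eq)
  qed
  show ?thesis
  proof (rule ccontr)
    assume "\<not> ?thesis"
    then have "\<forall>\<^sub>F y in at x. ereal (max ((A + B * ?w x) - (A + B * ?w y)) 0 / dist x y) < ereal B"
      unfolding subslope_def not_le by (rule Limsup_lessD)
    then obtain d where d: "d > 0" "\<And>y. y \<noteq> x \<Longrightarrow> dist y x < d \<Longrightarrow>
        max ((A + B * ?w x) - (A + B * ?w y)) 0 / dist x y < B"
      unfolding eventually_at by auto
    then show False using near[OF d(1)] by force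
  qed
qed

lemma lim_inf_subslope_ge:
  fixes x0 :: "'a::metric_space"
  assumes "r > 0" and ge: "\<And>x. x \<in> ball x0 r \<Longrightarrow> c \<le> subslope v x"
  shows "c \<le> lim_inf_subslope v x0"
proof (rule tendsto_lowerbound[OF tendsto_lim_inf_subslope])
  have "c \<le> (INF x\<in>ball x0 s. subslope v x)" if "s < r" for s
    using that by (intro INF_greatest ge) auto
  then show "\<forall>\<^sub>F s in at_right 0. c \<le> (INF x\<in>ball x0 s. subslope v x)"
    using assms(1) unfolding eventually_at_right_field by blast
qed simp

section \<open>Stability of the inradius\<close>

text \<open>
  Since every boundary point of \<open>\<Omega>\<close> is a limit of exterior points of \<open>closure \<Omega>\<close>, compactness
  gives finitely many exterior points that are \<open>\<eta>\<close>-dense around \<open>\<partial>\<Omega>\<close>.  A sufficiently thin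
  neighbourhood of \<open>\<Omega>\<close> misses all of them, so its boundary stays within \<open>\<eta>\<close> of \<open>\<partial>\<Omega>\<close>.
\<close>

lemma infdist_frontier_approximation:
  fixes \<Omega> :: "'a::metric_space set"
  assumes proper: "proper_space TYPE('a)" and geo: "geodesic_space TYPE('a)"
    and \<Omega>: "bounded \<Omega>" "\<Omega> \<noteq> {}" "\<Omega> \<noteq> UNIV" "frontier \<Omega> = frontier (closure \<Omega>)"
    and "\<eta> > 0"
  obtains \<delta> where "\<delta> > 0"
    "\<And>W x. W \<subseteq> nbhd \<delta> \<Omega> \<Longrightarrow> x \<in> W \<Longrightarrow>
       infdist x (frontier W) \<le> infdist x (frontier \<Omega>) + \<eta>"
proof -
  obtain c r where "\<Omega> \<subseteq> cball c r"
    using \<Omega>(1) by (auto simp: bounded_subset_cball)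
  then have "frontier \<Omega> \<subseteq> cball c r"
    using closure_minimal[of \<Omega> "cball c r"] by (auto simp: frontier_def)
  moreover have "compact (cball c r)"
    using proper by (auto simp: proper_space_def)
  ultimately have "compact (frontier \<Omega>)"
    by (metis compact_Int_closed frontier_closed inf.absorb_iff2)
  moreover have "frontier \<Omega> \<subseteq> (\<Union>z\<in>- closure \<Omega>. ball z \<eta>)"
  proof
    fix y assume "y \<in> frontier \<Omega>"
    then have "y \<in> closure (- closure \<Omega>)"
      unfolding \<Omega>(4) by (simp add: frontier_closures)
    then obtain z where "z \<in> - closure \<Omega>" "dist z y < \<eta>"
      using \<open>\<eta> > 0\<close> unfolding closure_approachable by blast
    then show "y \<in> (\<Union>z\<in>- closure \<Omega>. ball z \<eta>)" by auto
  qed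
  ultimately obtain Z where Z: "Z \<subseteq> - closure \<Omega>" "finite Z" "frontier \<Omega> \<subseteq> (\<Union>z\<in>Z. ball z \<eta>)"
    using compactE_image[of "frontier \<Omega>" "- closure \<Omega>" "\<lambda>z. ball z \<eta>"] by auto
  \<comment> \<open>The entry \<open>1\<close> only keeps the minimum defined should \<open>Z\<close> be empty.\<close>
  define \<delta> where "\<delta> = Min (insert 1 ((\<lambda>z. infdist z (closure \<Omega>)) ` Z))"
  have "infdist z (closure \<Omega>) > 0" if "z \<in> Z" for z
    using that Z(1) \<Omega>(2) by (intro infdist_pos_not_in_closed) auto
  then have "\<delta> > 0" using Z(2) by (simp add: \<delta>_def)
  moreover have "infdist x (frontier W) \<le> infdist x (frontier \<Omega>) + \<eta>"
    if W: "W \<subseteq> nbhd \<delta> \<Omega>" "x \<in> W" for W x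
  proof -
    have "infdist x (frontier W) - \<eta> \<le> dist x y" if y: "y \<in> frontier \<Omega>" for y
    proof -
      obtain z where z: "z \<in> Z" "dist z y < \<eta>"
        using Z(3) y by auto
      have "\<delta> \<le> infdist z (closure \<Omega>)"
        using Z(2) z(1) by (simp add: \<delta>_def)
      then have "z \<notin> W" using W(1) by (auto simp: nbhd_def)
      then show ?thesis
        using infdist_frontier_le_dist_outside[OF geo W(2), of z] z(2) dist_triangle[of x z y]
        by (simp add: dist_commute)
    qed
    moreover have "frontier \<Omega> \<noteq> {}"
      using geodesic_space_frontier_nonempty[OF geo \<Omega>(2,3)] .
    ultimately have "infdist x (frontier W) - \<eta> \<le> infdist x (frontier \<Omega>)"
      by (simp add: infdist_def[of x "frontier \<Omega>"] cINF_greatest)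
    then show ?thesis by simp
  qed
  ultimately show ?thesis using that by blast
qed

section \<open>The maximum principle\<close>

text \<open>
  With \<open>g(t) = t - \<epsilon> t\<^sup>2\<close>, the inequality \<open>g' > \<lambda> g\<close> on \<open>(0, S]\<close> tends to \<open>1 > \<lambda> t\<close> as \<open>\<epsilon>\<close>
  tends to \<open>0\<close>; the room left by \<open>\<lambda> R < 1\<close> is shared between \<open>S - R\<close> and \<open>\<epsilon>\<close>.
\<close>

lemma concave_profile_exists:
  fixes lam R :: real
  assumes R: "R \<ge> 0" "lam * R < 1"
  obtains S \<epsilon> where "S > R" "\<epsilon> > 0"
    "\<And>t. 0 < t \<Longrightarrow> t \<le> S \<Longrightarrow> t - \<epsilon> * t\<^sup>2 > 0 \<and> 1 - 2 * \<epsilon> * t > 0 \<and>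
       lam * (t - \<epsilon> * t\<^sup>2) < 1 - 2 * \<epsilon> * t"
proof -
  \<comment> \<open>With a nonnegative coefficient, \<open>L * t\<close> is at most \<open>L * S\<close>, also for negative \<open>lam\<close>.\<close>
  define L where "L = max lam 0"
  have L: "L \<ge> 0" "lam \<le> L" "L * R < 1"
    using R by (auto simp: L_def max_def)
  define S where "S = R + (1 - L * R) / (2 * (L + 1))"
  have SR: "S > R" using L by (simp add: S_def)
  then have S: "S > 0" using R by simp
  have "L * S * (2 * (L + 1)) = 2 * (L + 1) * (L * R) + L * (1 - L * R)"
    using L by (simp add: S_def field_simps)
  also have "\<dots> = (L + 2) * (L * R) + L" by (simp add: algebra_simps)
  also have "\<dots> < (L + 2) * 1 + L"
    using L by (intro add_strict_right_mono mult_strict_left_mono) auto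
  also have "\<dots> = 1 * (2 * (L + 1))" by simp
  finally have LS: "L * S < 1"
    using L(1) by (simp add: mult_less_cancel_right)
  define \<epsilon> where "\<epsilon> = (1 - L * S) / (4 * S)"
  have e: "\<epsilon> > 0" "2 * \<epsilon> * S = (1 - L * S) / 2"
    using LS S by (simp_all add: \<epsilon>_def field_simps)
  have "L * S \<ge> 0" using L S by simp
  have "t - \<epsilon> * t\<^sup>2 > 0 \<and> 1 - 2 * \<epsilon> * t > 0 \<and> lam * (t - \<epsilon> * t\<^sup>2) < 1 - 2 * \<epsilon> * t"
    if t: "0 < t" "t \<le> S" for t
  proof -
    have "\<epsilon> * t \<le> \<epsilon> * S" using e t by simp
    then have et: "2 * \<epsilon> * t \<le> (1 - L * S) / 2" using e(2) by linarith
    moreover have "(1 - L * S) / 2 < 1 - L * S" "(1 - L * S) / 2 < 1"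
      using LS \<open>L * S \<ge> 0\<close> by auto
    ultimately have et': "2 * \<epsilon> * t < 1 - L * S" "\<epsilon> * t < 1"
      using e(1) t(1) by (simp_all add: mult.assoc)
    then have pos: "t - \<epsilon> * t\<^sup>2 > 0"
      using t mult_strict_right_mono[of "\<epsilon> * t" 1 t] by (simp add: power2_eq_square)
    have "lam * (t - \<epsilon> * t\<^sup>2) \<le> L * (t - \<epsilon> * t\<^sup>2)"
      using pos L by (intro mult_right_mono) auto
    also have "\<dots> \<le> L * S"
      using L t e by (intro mult_left_mono) (auto intro: order_trans[of _ t])
    also have "\<dots> < 1 - 2 * \<epsilon> * t" using et'(1) by linarith
    finally show ?thesis using pos et'(1) \<open>L * S \<ge> 0\<close> by linarith
  qed
  then show ?thesis using that SR e(1) by blast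
qed

text \<open>
  The test function is affine in \<open>d(\<cdot>, \<partial>E)\<close>, with the tangent line of \<open>M g\<close> at \<open>t0\<close> as profile.
  Strictness has two sources: the quadratic gap \<open>M \<epsilon> (t - t0)\<^sup>2\<close> between \<open>M g\<close> and its tangent,
  and assumption (A) where that gap vanishes.
\<close>

lemma subsolution_touched_by_profile:
  fixes \<Omega> W :: "'a::metric_space set"
  assumes proper: "proper_space TYPE('a)" and geo: "geodesic_space TYPE('a)"
    and sub: "eikonal_infinity_subsolution lam \<Omega> u"
    and \<Omega>: "open \<Omega>" "\<Omega> \<subseteq> W" and A: "assumption_A W"
    and x0: "x0 \<in> \<Omega>" and t0: "t0 = infdist x0 (frontier W)"
    and "M > 0" "\<epsilon> > 0" and slope: "1 - 2 * \<epsilon> * t0 > 0"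
    and touch: "u x0 = M * (t0 - \<epsilon> * t0\<^sup>2)"
    and above: "\<And>x. x \<in> \<Omega> \<Longrightarrow>
      u x \<le> M * (infdist x (frontier W) - \<epsilon> * (infdist x (frontier W))\<^sup>2)"
  shows "1 - 2 * \<epsilon> * t0 \<le> lam * (t0 - \<epsilon> * t0\<^sup>2)"
proof -
  have "x0 \<in> W" using x0 \<Omega>(2) by blast
  then have "\<exists>r1>0. \<exists>E. metric_domain E \<and> E \<noteq> UNIV \<and> W \<subseteq> E \<and> E \<subseteq> nbhd 1 W \<and>
      infdist x0 (frontier E) = t0 \<and>
      (\<forall>x\<in>ball x0 r1 - {x0}. infdist x (frontier W) = t0 \<longrightarrow>
         infdist x (frontier E) > infdist x (frontier W))"
    unfolding t0
    by (rule mp[OF spec[OF bspec[OF A[unfolded assumption_A_def]]] zero_less_one])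
  then obtain r1 E where r1: "r1 > 0" and E: "metric_domain E" "E \<noteq> UNIV" "W \<subseteq> E"
    and eq: "infdist x0 (frontier E) = t0"
    and gt: "\<forall>x\<in>ball x0 r1 - {x0}. infdist x (frontier W) = t0 \<longrightarrow>
        infdist x (frontier E) > infdist x (frontier W)"
    by (elim exE conjE) (rule that)
  have oE: "open E" using E(1) by (simp add: metric_domain_def)
  obtain r2 where r2: "r2 > 0" "ball x0 r2 \<subseteq> \<Omega>"
    using \<Omega>(1) x0 open_contains_ball by blast
  define r where "r = min r1 r2"
  have r: "r > 0" "ball x0 r \<subseteq> \<Omega>"
    using r1 r2 by (auto simp: r_def)
  then have rE: "ball x0 r \<subseteq> E" using \<Omega>(2) E(3) by blast
  define B where "B = M * (1 - 2 * \<epsilon> * t0)"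
  have B: "B > 0" using \<open>M > 0\<close> slope by (simp add: B_def)
  define v where "v = (\<lambda>x. (M * (t0 - \<epsilon> * t0\<^sup>2) - B * t0) + B * infdist x (frontier E))"
  have vx0: "u x0 - v x0 = 0" by (simp add: v_def eq touch)
  have "u x - v x < 0" if x: "x \<in> ball x0 r" "x \<noteq> x0" for x
  proof -
    define t where "t = infdist x (frontier W)"
    have xW: "x \<in> W" using x r \<Omega>(2) by auto
    have ge: "infdist x (frontier E) \<ge> t"
      unfolding t_def using infdist_frontier_mono[OF geo xW E(3) oE E(2)] .
    have "u x \<le> M * (t - \<epsilon> * t\<^sup>2)" using above x r unfolding t_def by blast
    also have "\<dots> = (M * (t0 - \<epsilon> * t0\<^sup>2) - B * t0) + B * t - M * \<epsilon> * (t - t0)\<^sup>2"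
      by (simp add: B_def algebra_simps power2_eq_square)
    finally have *: "u x \<le> v x - B * (infdist x (frontier E) - t) - M * \<epsilon> * (t - t0)\<^sup>2"
      by (simp add: v_def algebra_simps)
    have nn: "B * (infdist x (frontier E) - t) \<ge> 0" "M * \<epsilon> * (t - t0)\<^sup>2 \<ge> 0"
      using B ge \<open>M > 0\<close> \<open>\<epsilon> > 0\<close> by simp_all
    show ?thesis
    proof (cases "t = t0")
      case True
      then have "infdist x (frontier E) > t"
        using gt x by (auto simp: r_def t_def)
      then have "B * (infdist x (frontier E) - t) > 0" using B by simp
      then show ?thesis using * nn by linarith
    next
      case False
      then have "M * \<epsilon> * (t - t0)\<^sup>2 > 0" using \<open>M > 0\<close> \<open>\<epsilon> > 0\<close> by simp
      then show ?thesis using * nn by linarith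
    qed
  qed
  then have "strict_local_max (\<lambda>x. u x - v x) x0"
    unfolding strict_local_max_def vx0 eventually_at
    using r(1) by (intro exI[of _ r]) (auto simp: dist_commute)
  moreover have "infinity_superharmonic (ball x0 r) v"
    unfolding v_def by (rule infinity_superharmonic_affine_infdist[OF geo oE E(2) rE B])
  ultimately have "lim_inf_subslope v x0 \<le> ereal (lam * u x0)"
    using sub x0 r unfolding eikonal_infinity_subsolution_def by blast
  moreover have "ereal B \<le> subslope v x" if "x \<in> ball x0 r" for x
    unfolding v_def using subslope_affine_infdist_ge[OF proper geo oE E(2) _ B] that rE by blast
  then have "ereal B \<le> lim_inf_subslope v x0"
    using lim_inf_subslope_ge[OF r(1)] by blast
  ultimately have "ereal B \<le> ereal (lam * u x0)" by (rule order_trans[rotated])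
  then have "M * (1 - 2 * \<epsilon> * t0) \<le> M * (lam * (t0 - \<epsilon> * t0\<^sup>2))"
    by (simp add: B_def touch mult_ac)
  then show ?thesis using \<open>M > 0\<close> by simp
qed

theorem theorem3p10:
  fixes \<Omega> :: "'a::metric_space set"
    and u :: "'a \<Rightarrow> real"
    and lam :: real
  assumes "proper_space TYPE('a)"
    and "geodesic_space TYPE('a)"
    and "metric_domain \<Omega>" and "bounded \<Omega>" and "\<Omega> \<noteq> UNIV"
    and "frontier \<Omega> = frontier (closure \<Omega>)"
    and "\<forall>\<delta>>0. \<exists>\<Omega>\<^sub>\<delta>.
           metric_domain \<Omega>\<^sub>\<delta> \<and> bounded \<Omega>\<^sub>\<delta> \<and> \<Omega>\<^sub>\<delta> \<noteq> UNIV \<and>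
           closure \<Omega> \<subseteq> \<Omega>\<^sub>\<delta> \<and> \<Omega>\<^sub>\<delta> \<subseteq> nbhd \<delta> \<Omega> \<and>
           frontier \<Omega>\<^sub>\<delta> = frontier (closure \<Omega>\<^sub>\<delta>) \<and>
           (INF x\<in>closure \<Omega>. infdist x (frontier \<Omega>\<^sub>\<delta>)) > 0 \<and>
           assumption_A \<Omega>\<^sub>\<delta>"
    and "lam < 1 / (SUP x\<in>closure \<Omega>. infdist x (frontier \<Omega>))"
    and "continuous_on (closure \<Omega>) u"
    and "eikonal_infinity_subsolution lam \<Omega> u"
    and "\<forall>x\<in>frontier \<Omega>. u x \<le> 0"
  shows "\<forall>x\<in>closure \<Omega>. u x \<le> 0"
proof (rule ccontr)
  assume "\<not> ?thesis"
  then obtain x1 where x1: "x1 \<in> closure \<Omega>" "u x1 > 0" by force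
  note proper = assms(1) and geo = assms(2)
  have \<Omega>: "open \<Omega>" "\<Omega> \<noteq> {}" using assms(3) by (auto simp: metric_domain_def)
  obtain c r where "\<Omega> \<subseteq> cball c r"
    using assms(4) by (auto simp: bounded_subset_cball)
  moreover have "compact (cball c r)"
    using proper by (auto simp: proper_space_def)
  ultimately have comp: "compact (closure \<Omega>)"
    by (metis closed_cball closed_closure closure_minimal compact_Int_closed inf.absorb_iff2)
  define R where "R = (SUP x\<in>closure \<Omega>. infdist x (frontier \<Omega>))"
  have "compact ((\<lambda>x. infdist x (frontier \<Omega>)) ` closure \<Omega>)"
    using comp by (intro compact_continuous_image continuous_intros)
  then have "bdd_above ((\<lambda>x. infdist x (frontier \<Omega>)) ` closure \<Omega>)"
    by (intro bounded_imp_bdd_above compact_imp_bounded)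
  then have leR: "infdist x (frontier \<Omega>) \<le> R" if "x \<in> closure \<Omega>" for x
    unfolding R_def using that by (intro cSUP_upper)
  have "R \<ge> 0" using leR[OF x1(1)] infdist_nonneg[of x1] by (meson order_trans)
  moreover have "lam * R < 1"
    using assms(8) \<open>R \<ge> 0\<close> unfolding R_def[symmetric]
    by (cases "R = 0") (auto simp: pos_less_divide_eq)
  ultimately obtain S \<epsilon> where S: "S > R" and eps: "\<epsilon> > 0"
    and g: "\<And>t. 0 < t \<Longrightarrow> t \<le> S \<Longrightarrow> t - \<epsilon> * t\<^sup>2 > 0 \<and> 1 - 2 * \<epsilon> * t > 0 \<and>
       lam * (t - \<epsilon> * t\<^sup>2) < 1 - 2 * \<epsilon> * t"
    using concave_profile_exists by blast
  obtain \<delta> where d: "\<delta> > 0" "\<And>W x. W \<subseteq> nbhd \<delta> \<Omega> \<Longrightarrow> x \<in> W \<Longrightarrow>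
       infdist x (frontier W) \<le> infdist x (frontier \<Omega>) + (S - R)"
    using infdist_frontier_approximation[OF proper geo assms(4) \<Omega>(2) assms(5,6), of "S - R"] S
    by auto
  obtain W where W: "metric_domain W" "W \<noteq> UNIV" "closure \<Omega> \<subseteq> W" "W \<subseteq> nbhd \<delta> \<Omega>"
    "assumption_A W"
    using assms(7) d(1) by blast
  let ?w = "\<lambda>x. infdist x (frontier W)"
  have wpos: "?w x > 0" if "x \<in> closure \<Omega>" for x
  proof (rule infdist_pos_not_in_closed[OF frontier_closed])
    show "frontier W \<noteq> {}"
      using geodesic_space_frontier_nonempty[OF geo _ W(2)] W(1) by (simp add: metric_domain_def)
    show "x \<notin> frontier W"
      using that W(1,3) by (auto simp: metric_domain_def frontier_def interior_open)
  qed
  have wle: "?w x \<le> S" if "x \<in> closure \<Omega>" for x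
    using d(2)[OF W(4), of x] leR[OF that] W(3) that by force
  have gw: "?w x - \<epsilon> * (?w x)\<^sup>2 > 0" if "x \<in> closure \<Omega>" for x
    using g wpos wle that by blast
  let ?f = "\<lambda>x. u x / (?w x - \<epsilon> * (?w x)\<^sup>2)"
  have cont: "continuous_on (closure \<Omega>) ?f"
    using gw assms(9) by (intro continuous_intros) force+
  have "closure \<Omega> \<noteq> {}" using \<Omega>(2) by simp
  from continuous_attains_sup[OF comp this cont]
  obtain x0 where x0: "x0 \<in> closure \<Omega>" and mx: "\<forall>x\<in>closure \<Omega>. ?f x \<le> ?f x0"
    by (elim bexE)
  have "?f x1 > 0" using x1(2) gw[OF x1(1)] by (rule divide_pos_pos)
  then have M: "?f x0 > 0" using bspec[OF mx x1(1)] by (rule less_le_trans)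
  then have "u x0 > 0" using gw[OF x0] by (simp add: zero_less_divide_iff)
  then have "x0 \<notin> frontier \<Omega>" using bspec[OF assms(11), of x0] by linarith
  then have "x0 \<in> \<Omega>" using x0 \<Omega>(1) by (simp add: frontier_def interior_open)
  have "1 - 2 * \<epsilon> * ?w x0 \<le> lam * (?w x0 - \<epsilon> * (?w x0)\<^sup>2)"
  proof (rule subsolution_touched_by_profile
      [OF proper geo assms(10) \<Omega>(1) _ W(5) \<open>x0 \<in> \<Omega>\<close> refl M eps])
    show "\<Omega> \<subseteq> W" using W(3) closure_subset by blast
    show "1 - 2 * \<epsilon> * ?w x0 > 0" using g[OF wpos[OF x0] wle[OF x0]] by simp
    show "u x0 = ?f x0 * (?w x0 - \<epsilon> * (?w x0)\<^sup>2)" using gw[OF x0] by simp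
    show "u x \<le> ?f x0 * (?w x - \<epsilon> * (?w x)\<^sup>2)" if "x \<in> \<Omega>" for x
    proof -
      have "x \<in> closure \<Omega>" using that closure_subset by blast
      then show ?thesis using bspec[OF mx, of x] gw[of x] by (simp add: pos_divide_le_eq)
    qed
  qed
  then show False using g[OF wpos[OF x0] wle[OF x0]] by linarith
qed

end
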